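(* For every $m\in\mathbb N$, there is a deterministic $2$-competitive online algorithm for Online Makespan Scheduling under Scenarios with $m$ machines and $K=3$ scenarios, restricted to instances with unit processing times $p_j=1$ for all jobs $j$.
   Context: Online Makespan Scheduling under Scenarios with $m$ machines and $K$ scenarios (both known in advance): an instance consists of $n$ jobs with processing times $p_j\ge0$ and scenarios $S_1,\dots,S_K\subseteq[n]$ (not known in advance); jobs are revealed in order $1,\dots,n$, and on revelation of job $j$ the algorithm learns $p_j$ and which scenarios contain $j$, and must irrevocably assign $j$ to a machine $\tau(j)\in[m]$. With $J_i=\tau^{-1}(i)$ and $p(S)=\sum_{j\in S}p_j$, the makespan is $\max_{k}\max_i p(J_i\cap S_k)$; an algorithm is $\rho$-competitive if its makespan is always at most $\rho$ times the offline optimum (minimum makespan over all partitions of $[n]$ into $m$ machines). *)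

theory Defs
  imports Complex_Main "HOL-Library.FuncSet"
begin

text \<open>Jobs, machines and scenarios are numbered from 1: the jobs of an instance are
  \<open>{1..num_jobs I}\<close>, the machines are \<open>{1..m}\<close> and the scenarios are \<open>{1..K}\<close>.\<close>

record sched_instance =
  num_jobs :: nat
  ptime :: "nat \<Rightarrow> real"
  scenario :: "nat \<Rightarrow> nat set"

definition valid_instance :: "nat \<Rightarrow> sched_instance \<Rightarrow> bool" where
  "valid_instance K I \<longleftrightarrow>
     (\<forall>j\<in>{1..num_jobs I}. 0 \<le> ptime I j) \<and>
     (\<forall>k\<in>{1..K}. scenario I k \<subseteq> {1..num_jobs I})"

definition unit_instance :: "sched_instance \<Rightarrow> bool" where
  "unit_instance I \<longleftrightarrow> (\<forall>j\<in>{1..num_jobs I}. ptime I j = 1)"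

definition total_ptime :: "sched_instance \<Rightarrow> nat set \<Rightarrow> real" where
  "total_ptime I S = (\<Sum>j\<in>S. ptime I j)"

definition machine_jobs :: "sched_instance \<Rightarrow> (nat \<Rightarrow> nat) \<Rightarrow> nat \<Rightarrow> nat set" where
  "machine_jobs I \<tau> i = {j \<in> {1..num_jobs I}. \<tau> j = i}"

definition makespan :: "nat \<Rightarrow> nat \<Rightarrow> sched_instance \<Rightarrow> (nat \<Rightarrow> nat) \<Rightarrow> real" where
  "makespan m K I \<tau> =
     (MAX k\<in>{1..K}. MAX i\<in>{1..m}. total_ptime I (machine_jobs I \<tau> i \<inter> scenario I k))"

definition opt_makespan :: "nat \<Rightarrow> nat \<Rightarrow> sched_instance \<Rightarrow> real" where
  "opt_makespan m K I = (MIN \<tau>\<in>{1..num_jobs I} \<rightarrow>\<^sub>E {1..m}. makespan m K I \<tau>)"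

definition revealed :: "nat \<Rightarrow> sched_instance \<Rightarrow> nat \<Rightarrow> real \<times> nat set" where
  "revealed K I j = (ptime I j, {k\<in>{1..K}. j \<in> scenario I k})"

text \<open>A deterministic online algorithm maps the data of all jobs revealed so far, the last
  entry being the job to be assigned now, to a machine. Its own earlier decisions are a
  function of that data, so they need not be a separate argument. The number of jobs
  still to come is not part of the data.\<close>

type_synonym online_rule = "(real \<times> nat set) list \<Rightarrow> nat"

definition online_algorithm :: "nat \<Rightarrow> online_rule \<Rightarrow> bool" where
  "online_algorithm m A \<longleftrightarrow> (\<forall>h. A h \<in> {1..m})"

definition online_assignment :: "nat \<Rightarrow> online_rule \<Rightarrow> sched_instance \<Rightarrow> nat \<Rightarrow> nat" where
  "online_assignment K A I j = A (map (revealed K I) [1..<Suc j])"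

definition competitive_on ::
  "(sched_instance \<Rightarrow> bool) \<Rightarrow> real \<Rightarrow> nat \<Rightarrow> nat \<Rightarrow> online_rule \<Rightarrow> bool" where
  "competitive_on P \<rho> m K A \<longleftrightarrow>
     (\<forall>I. valid_instance K I \<and> P I \<longrightarrow>
        makespan m K I (online_assignment K A I) \<le> \<rho> * opt_makespan m K I)"

end

theory Submission imports Defs begin

text \<open>
  Let \<open>L\<close> be the least integer with \<open>|S\<^sub>k| \<le> m L\<close> for all \<open>k\<close>, at the current time; the optimum is
  at least \<open>L\<close>. The algorithm keeps two invariants on each machine: every scenario has load at
  most \<open>2 L\<close>, and at most \<open>L\<close> of the jobs lie in scenario \<open>k\<close> only. Suppose no machine can take a
  new job with scenario set \<open>T\<close>. Then on every machine the loads of the scenarios in \<open>T\<close> sum to at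
  least \<open>|T| L\<close>. This is clear for \<open>|T| \<le> 2\<close>. For \<open>|T| = 3\<close>, a machine with load \<open>2 L\<close> in some
  scenario \<open>k\<close> has at least \<open>L\<close> jobs that lie in \<open>k\<close> and in another scenario, so its three loads
  sum to at least \<open>3 L\<close>. Summing over the machines gives \<open>m |T| L\<close>, whereas before the arrival each
  of the \<open>|T|\<close> scenarios has fewer than \<open>m L\<close> jobs.
\<close>

section \<open>Loads and the invariant\<close>

type_synonym schedule = "(nat set \<times> nat) list"

definition load :: "schedule \<Rightarrow> nat \<Rightarrow> nat \<Rightarrow> nat" where
  "load s i k = length (filter (\<lambda>(T, i'). i' = i \<and> k \<in> T) s)"

definition single_load :: "schedule \<Rightarrow> nat \<Rightarrow> nat \<Rightarrow> nat" where
  "single_load s i k = length (filter (\<lambda>(T, i'). i' = i \<and> T = {k}) s)"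

definition scenario_size :: "nat set list \<Rightarrow> nat \<Rightarrow> nat" where
  "scenario_size Ts k = length (filter (\<lambda>T. k \<in> T) Ts)"

text \<open>The bounds weaken as \<open>L\<close> grows, so asking for them at every admissible
  \<open>L\<close> amounts to asking at the least one.\<close>

definition balanced :: "nat \<Rightarrow> schedule \<Rightarrow> bool" where
  "balanced m s \<longleftrightarrow>
     (\<forall>L. (\<forall>k\<in>{1..3}. scenario_size (map fst s) k \<le> m * L) \<longrightarrow>
        (\<forall>i\<in>{1..m}. \<forall>k\<in>{1..3}. load s i k \<le> 2 * L \<and> single_load s i k \<le> L))"

lemma load_simps [simp]:
  "load [] i k = 0"
  "load ((T, i') # s) i k = (if i' = i \<and> k \<in> T then 1 else 0) + load s i k"
  by (auto simp: load_def)

lemma single_load_simps [simp]: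
  "single_load [] i k = 0"
  "single_load ((T, i') # s) i k = (if i' = i \<and> T = {k} then 1 else 0) + single_load s i k"
  by (auto simp: single_load_def)

lemma scenario_size_simps [simp]:
  "scenario_size [] k = 0"
  "scenario_size (T # Ts) k = (if k \<in> T then 1 else 0) + scenario_size Ts k"
  by (auto simp: scenario_size_def)

lemma single_load_le_load: "single_load s i k \<le> load s i k"
  by (induction s) auto

text \<open>Every job sits on exactly one machine of \<open>{1..m}\<close>, so it is counted once on
  the left.\<close>

lemma sum_load:
  assumes "snd ` set s \<subseteq> {1..m}"
  shows "(\<Sum>i=1..m. load s i k) = scenario_size (map fst s) k"
  using assms
proof (induction s)
  case (Cons x s)
  obtain T i where x: "x = (T, i)" by fastforce
  show ?case
  proof (cases "k \<in> T")
    case True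
    have "(\<Sum>i'=1..m. load (x # s) i' k) =
        (\<Sum>i'=1..m. if i' = i then 1 else 0) + (\<Sum>i'=1..m. load s i' k)"
      unfolding sum.distrib[symmetric] by (rule sum.cong) (auto simp: x True)
    then show ?thesis using Cons by (simp add: x True)
  next
    case False
    then show ?thesis using Cons by (simp add: x)
  qed
qed simp

text \<open>Each job counted in \<open>load s i k\<close> either lies in a second scenario or is counted in
  \<open>single_load s i k\<close>.\<close>

lemma twice_load_le:
  assumes "finite K" "k \<in> K" "\<forall>T\<in>fst ` set s. T \<subseteq> K"
  shows "2 * load s i k \<le> (\<Sum>k'\<in>K. load s i k') + single_load s i k"
  using assms(3)
proof (induction s)
  case (Cons x s)
  obtain T i' where x: "x = (T, i')" by fastforce
  have IH: "2 * load s i k \<le> (\<Sum>k'\<in>K. load s i k') + single_load s i k"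
    using Cons by simp
  have T: "T \<subseteq> K" using Cons.prems by (simp add: x)
  show ?case
  proof (cases "i' = i")
    case True
    have "(\<Sum>k'\<in>K. load (x # s) i k') =
        (\<Sum>k'\<in>K. if k' \<in> T then 1 else 0) + (\<Sum>k'\<in>K. load s i k')"
      by (simp add: x True flip: sum.distrib)
    also have "(\<Sum>k'\<in>K. if k' \<in> T then 1 else 0 :: nat) = card T"
      using T assms(1) by (simp add: Int_absorb1 flip: sum.inter_filter Int_def Collect_mem_eq)
    finally have eq: "(\<Sum>k'\<in>K. load (x # s) i k') = card T + (\<Sum>k'\<in>K. load s i k')" .
    \<comment> \<open>If the new job lies in scenario \<open>k\<close>, the left side grows by 2 and
      the right side by exactly this amount.\<close>
    have "2 \<le> card T + (if T = {k} then 1 else 0)" if "k \<in> T"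
    proof (cases "T = {k}")
      case False
      then obtain l where "l \<in> T" "l \<noteq> k" using \<open>k \<in> T\<close> by auto
      then have "card {k, l} \<le> card T"
        using \<open>k \<in> T\<close> T assms(1) by (intro card_mono) (auto intro: finite_subset)
      then show ?thesis using \<open>l \<noteq> k\<close> by simp
    qed simp
    then show ?thesis unfolding eq using IH by (cases "k \<in> T"; cases "T = {k}") (auto simp: x True)
  next
    case False
    then show ?thesis using IH by (simp add: x)
  qed
qed simp

text \<open>Here \<open>blocked\<close> says that a job of type \<open>T\<close> on machine
  \<open>i\<close> would push a load above \<open>2 * L\<close> or, for a singleton type, the single
  load above \<open>L\<close>.\<close>

lemma sum_load_ge_if_blocked:
  assumes T: "T \<subseteq> {1..3}" and types: "\<forall>T\<in>fst ` set s. T \<subseteq> {1..3}"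
    and single: "\<forall>k\<in>{1..3}. single_load s i k \<le> L"
    and blocked: "\<exists>k\<in>T. 2 * L \<le> load s i k \<or> (T = {k} \<and> L \<le> single_load s i k)"
  shows "card T * L \<le> (\<Sum>k\<in>T. load s i k)"
proof -
  obtain k where k: "k \<in> T" "2 * L \<le> load s i k \<or> (T = {k} \<and> L \<le> single_load s i k)"
    using blocked by blast
  have fin: "finite T" using T finite_subset by blast
  have load_le: "load s i k \<le> (\<Sum>k\<in>T. load s i k)"
    using member_le_sum[OF k(1) _ fin, of "load s i"] by simp
  have card_le: "card T \<le> 3" using card_mono[OF _ T] by simp
  consider "T = {k}" | "T \<noteq> {k}" "card T \<le> 2" | "T \<noteq> {k}" "card T = 3"
    using card_le by linarith
  then show ?thesis
  proof cases
    case 1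
    then show ?thesis using k single_load_le_load[of s i k] by auto
  next
    case 2
    then have "card T * L \<le> 2 * L" by simp
    then show ?thesis using k 2 load_le by linarith
  next
    case 3
    then have eq: "T = {1..3}" using T card_subset_eq[of "{1..3}" T] by simp
    then have "single_load s i k \<le> L" using k single by blast
    \<comment> \<open>As \<open>load s i k\<close> is at least \<open>2 * L\<close>, the left side
      is at least \<open>4 * L\<close>; removing the single load, at most \<open>L\<close>, leaves
      \<open>3 * L\<close>.\<close>
    moreover have "2 * load s i k \<le> (\<Sum>k\<in>T. load s i k) + single_load s i k"
      using twice_load_le[OF fin k(1)] types eq by simp
    ultimately show ?thesis using k 3 by auto
  qed
qed

lemma balanced_step:
  assumes m: "m \<ge> 1" and T: "T \<subseteq> {1..3}" and types: "\<forall>T\<in>fst ` set s. T \<subseteq> {1..3}"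
    and machines: "snd ` set s \<subseteq> {1..m}" and bal: "balanced m s"
  shows "\<exists>i\<in>{1..m}. balanced m ((T, i) # s)"
proof -
  let ?Ts = "T # map fst s"
  define L where "L = (LEAST L. \<forall>k\<in>{1..3}. scenario_size ?Ts k \<le> m * L)"
  \<comment> \<open>The list length is an admissible value, so the least one exists.\<close>
  have size_le: "scenario_size ?Ts k \<le> m * length ?Ts" for k
  proof -
    have "scenario_size ?Ts k \<le> length ?Ts" unfolding scenario_size_def by (rule length_filter_le)
    also have "\<dots> \<le> m * length ?Ts" using mult_le_mono1[OF m, of "length ?Ts"] by linarith
    finally show ?thesis .
  qed
  have L: "\<forall>k\<in>{1..3}. scenario_size ?Ts k \<le> m * L"
    unfolding L_def
    by (rule LeastI[of "\<lambda>L. \<forall>k\<in>{1..3}. scenario_size ?Ts k \<le> m * L" "length ?Ts"])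
      (use size_le in blast)
  have L_least: "L \<le> L'" if "\<forall>k\<in>{1..3}. scenario_size ?Ts k \<le> m * L'" for L'
    unfolding L_def by (rule Least_le) (use that in blast)
  \<comment> \<open>\<open>L\<close> counts the new job too; without it the sizes are no larger, so
    the old invariant is available at this \<open>L\<close>.\<close>
  have "\<forall>k\<in>{1..3}. scenario_size (map fst s) k \<le> m * L"
  proof
    fix k :: nat assume "k \<in> {1..3}"
    then have "scenario_size ?Ts k \<le> m * L" using L by blast
    then show "scenario_size (map fst s) k \<le> m * L" by simp
  qed
  then have inv: "load s i k \<le> 2 * L" "single_load s i k \<le> L" if "i \<in> {1..m}" "k \<in> {1..3}" for i k
    using bal that unfolding balanced_def by blast+
  have "\<exists>i\<in>{1..m}. \<forall>k\<in>T. load s i k < 2 * L \<and> (T = {k} \<longrightarrow> single_load s i k < L)"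
  proof (rule ccontr)
    assume "\<not> ?thesis"
    then have blocked: "\<exists>k\<in>T. 2 * L \<le> load s i k \<or> (T = {k} \<and> L \<le> single_load s i k)"
      if "i \<in> {1..m}" for i
      using that by (meson not_less)
    have "T \<noteq> {}" using blocked[of 1] m by auto
    have fin: "finite T" using T finite_subset by blast
    have "(\<Sum>i=1..m. card T * L) \<le> (\<Sum>i=1..m. \<Sum>k\<in>T. load s i k)"
    proof (rule sum_mono)
      fix i assume i: "i \<in> {1..m}"
      then have "\<forall>k\<in>{1..3}. single_load s i k \<le> L" using inv by blast
      then show "card T * L \<le> (\<Sum>k\<in>T. load s i k)"
        using sum_load_ge_if_blocked[OF T types] blocked[OF i] by blast
    qed
    also have "\<dots> = (\<Sum>k\<in>T. scenario_size (map fst s) k)"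
      using sum_load[OF machines] by (subst sum.swap) simp
    \<comment> \<open>Strict because the new job itself takes one unit of \<open>m * L\<close> in
      each scenario of \<open>T\<close>.\<close>
    also have "\<dots> < (\<Sum>k\<in>T. m * L)"
    proof (rule sum_strict_mono[OF fin \<open>T \<noteq> {}\<close>])
      fix k assume "k \<in> T"
      then have "scenario_size ?Ts k \<le> m * L" using L T by blast
      then show "scenario_size (map fst s) k < m * L" using \<open>k \<in> T\<close> by simp
    qed
    finally show False by simp
  qed
  then obtain i where i: "i \<in> {1..m}"
      "\<forall>k\<in>T. load s i k < 2 * L \<and> (T = {k} \<longrightarrow> single_load s i k < L)"
    by blast
  have "load ((T, i) # s) i' k \<le> 2 * L'" "single_load ((T, i) # s) i' k \<le> L'"
    if "\<forall>k\<in>{1..3}. scenario_size (map fst ((T, i) # s)) k \<le> m * L'"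
      and "i' \<in> {1..m}" "k \<in> {1..3}" for L' i' k
  proof -
    have "L \<le> L'" using that(1) by (intro L_least) simp
    then show "load ((T, i) # s) i' k \<le> 2 * L'" "single_load ((T, i) # s) i' k \<le> L'"
      using inv[OF that(2,3)] i(2) by (auto split: if_splits)
  qed
  then have "balanced m ((T, i) # s)" unfolding balanced_def by blast
  then show ?thesis using i(1) by blast
qed

section \<open>The online algorithm\<close>

text \<open>The jobs are listed with the most recent one first.\<close>

fun greedy :: "nat \<Rightarrow> nat set list \<Rightarrow> schedule" where
  "greedy m [] = []"
| "greedy m (T # Ts) =
     (let s = greedy m Ts; T' = T \<inter> {1..3}
      in (T', SOME i. i \<in> {1..m} \<and> balanced m ((T', i) # s)) # s)"

lemma map_fst_greedy: "map fst (greedy m Ts) = map (\<lambda>T. T \<inter> {1..3}) Ts"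
  by (induction Ts) (auto simp: Let_def)

text \<open>Cutting types down to \<open>{1..3}\<close> makes \<open>balanced_step\<close>
  applicable to any list, so \<open>SOME\<close> always has a witness. Arbitrary lists matter
  because an online rule must return a machine on every history.\<close>

lemma greedy_invariant:
  assumes "m \<ge> 1"
  shows "snd ` set (greedy m Ts) \<subseteq> {1..m} \<and> balanced m (greedy m Ts)"
proof (induction Ts)
  case Nil
  show ?case by (simp add: balanced_def)
next
  case (Cons T Ts)
  let ?s = "greedy m Ts" and ?T = "T \<inter> {1..3}"
  have "\<forall>T\<in>fst ` set ?s. T \<subseteq> {1..3}"
    unfolding set_map[symmetric] map_fst_greedy by auto
  then have "\<exists>i. i \<in> {1..m} \<and> balanced m ((?T, i) # ?s)"
    using balanced_step[OF assms, of ?T ?s] Cons.IH by blast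
  from someI_ex[OF this] show ?case using Cons.IH by (simp add: Let_def)
qed

text \<open>The empty history never occurs in a run; machine 1 is an arbitrary value there.\<close>

definition greedy_rule :: "nat \<Rightarrow> online_rule" where
  "greedy_rule m h = (if h = [] then 1 else snd (hd (greedy m (rev (map snd h)))))"

lemma online_algorithm_greedy_rule:
  assumes "m \<ge> 1"
  shows "online_algorithm m (greedy_rule m)"
  unfolding online_algorithm_def
proof
  fix h :: "(real \<times> nat set) list"
  show "greedy_rule m h \<in> {1..m}"
  proof (cases h rule: rev_cases)
    case Nil
    then show ?thesis using assms by (simp add: greedy_rule_def)
  next
    case (snoc h' x)
    then show ?thesis using greedy_invariant[OF assms, of "rev (map snd h)"]
      by (simp add: greedy_rule_def Let_def)
  qed
qed

text \<open>The rule reruns \<open>greedy\<close> on each history and keeps only the newest machine.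
  The reruns agree with one single run because \<open>greedy\<close> only prepends to its earlier
  schedule.\<close>

lemma greedy_eq_online_assignment:
  "greedy m (rev (map (snd \<circ> revealed 3 I) [1..<Suc n])) =
     rev (map (\<lambda>j. (snd (revealed 3 I j), online_assignment 3 (greedy_rule m) I j)) [1..<Suc n])"
proof (induction n)
  case (Suc n)
  let ?f = "snd \<circ> revealed 3 I" and ?\<sigma> = "online_assignment 3 (greedy_rule m) I"
  let ?Ts = "rev (map ?f [1..<Suc n])"
  have upt: "[1..<Suc (Suc n)] = [1..<Suc n] @ [Suc n]" by simp
  have "?f (Suc n) \<inter> {1..3} = ?f (Suc n)" by (auto simp: revealed_def)
  then obtain i where i: "greedy m (?f (Suc n) # ?Ts) = (?f (Suc n), i) # greedy m ?Ts"
    by (simp only: greedy.simps Let_def)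
  then have "?\<sigma> (Suc n) = i"
    unfolding online_assignment_def greedy_rule_def upt by (simp del: upt_Suc greedy.simps)
  then show ?case
    unfolding upt using i Suc.IH by (simp add: comp_def del: upt_Suc greedy.simps)
qed simp

section \<open>Comparison with the optimum\<close>

lemma length_filter_rev_map_upt:
  "length (filter P (rev (map f [1..<Suc n]))) = card {j \<in> {1..n}. P (f j)}"
proof -
  have "length (filter P (rev (map f [1..<Suc n]))) = length (filter (P \<circ> f) [1..<Suc n])"
    by (simp add: filter_map rev_filter[symmetric] del: upt_Suc)
  also have "\<dots> = card (set (filter (P \<circ> f) [1..<Suc n]))"
    by (rule distinct_card[symmetric]) simp
  also have "set (filter (P \<circ> f) [1..<Suc n]) = {j \<in> {1..n}. P (f j)}" by auto
  finally show ?thesis .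
qed

lemma total_ptime_unit:
  assumes "unit_instance I"
  shows "total_ptime I (machine_jobs I \<tau> i \<inter> S) = card {j \<in> {1..num_jobs I}. \<tau> j = i \<and> j \<in> S}"
proof -
  have "total_ptime I (machine_jobs I \<tau> i \<inter> S) = real (card (machine_jobs I \<tau> i \<inter> S))"
    unfolding real_of_card total_ptime_def using assms
    by (intro sum.cong) (auto simp: machine_jobs_def unit_instance_def)
  moreover have "machine_jobs I \<tau> i \<inter> S = {j \<in> {1..num_jobs I}. \<tau> j = i \<and> j \<in> S}"
    by (auto simp: machine_jobs_def)
  ultimately show ?thesis by (simp only:)
qed

lemma makespan_ge:
  assumes "k \<in> {1..K}" "i \<in> {1..m}"
  shows "total_ptime I (machine_jobs I \<tau> i \<inter> scenario I k) \<le> makespan m K I \<tau>"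
proof -
  have "total_ptime I (machine_jobs I \<tau> i \<inter> scenario I k)
      \<le> (MAX i\<in>{1..m}. total_ptime I (machine_jobs I \<tau> i \<inter> scenario I k))"
    using assms(2) by (intro Max_ge) auto
  also have "\<dots> \<le> makespan m K I \<tau>"
    unfolding makespan_def using assms(1) by (intro Max_ge) auto
  finally show ?thesis .
qed

lemma makespan_leI:
  assumes "m \<ge> 1" "K \<ge> 1"
    and "\<And>k i. k \<in> {1..K} \<Longrightarrow> i \<in> {1..m} \<Longrightarrow>
      total_ptime I (machine_jobs I \<tau> i \<inter> scenario I k) \<le> B"
  shows "makespan m K I \<tau> \<le> B"
  using assms unfolding makespan_def by (auto simp: Max_le_iff)

text \<open>Averaging over machines. Unit loads are integers, so rounding the makespan down is
  harmless and yields a value admissible as \<open>L\<close> in \<open>balanced\<close>.\<close>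

lemma scenario_card_le_makespan:
  assumes "unit_instance I" "k \<in> {1..K}" and \<tau>: "\<tau> \<in> {1..num_jobs I} \<rightarrow> {1..m}"
  shows "card {j \<in> {1..num_jobs I}. j \<in> scenario I k} \<le> m * nat \<lfloor>makespan m K I \<tau>\<rfloor>"
proof -
  let ?A = "\<lambda>i. {j \<in> {1..num_jobs I}. \<tau> j = i \<and> j \<in> scenario I k}"
  have "{j \<in> {1..num_jobs I}. j \<in> scenario I k} = (\<Union>i\<in>{1..m}. ?A i)"
    using \<tau> by auto
  then have "card {j \<in> {1..num_jobs I}. j \<in> scenario I k} \<le> (\<Sum>i\<in>{1..m}. card (?A i))"
    using card_UN_le[of "{1..m}" ?A] by simp
  also have "\<dots> \<le> (\<Sum>i\<in>{1..m}. nat \<lfloor>makespan m K I \<tau>\<rfloor>)"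
  proof (rule sum_mono)
    fix i assume "i \<in> {1..m}"
    then have "real (card (?A i)) \<le> makespan m K I \<tau>"
      using makespan_ge[OF assms(2)] total_ptime_unit[OF assms(1)] by metis
    then show "card (?A i) \<le> nat \<lfloor>makespan m K I \<tau>\<rfloor>" by (simp add: le_nat_floor)
  qed
  finally show ?thesis by simp
qed

lemma greedy_makespan_le:
  assumes m: "m \<ge> 1" and unit: "unit_instance I" and \<tau>: "\<tau> \<in> {1..num_jobs I} \<rightarrow> {1..m}"
  shows "makespan m 3 I (online_assignment 3 (greedy_rule m) I) \<le> 2 * makespan m 3 I \<tau>"
proof (rule makespan_leI[OF m])
  fix k i :: nat assume k: "k \<in> {1..3}" and i: "i \<in> {1..m}"
  let ?n = "num_jobs I" and ?\<sigma> = "online_assignment 3 (greedy_rule m) I"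
  let ?L = "nat \<lfloor>makespan m 3 I \<tau>\<rfloor>"
  define s where "s = rev (map (\<lambda>j. (snd (revealed 3 I j), ?\<sigma> j)) [1..<Suc ?n])"
  have bal: "balanced m s"
    using greedy_invariant[OF m] unfolding s_def greedy_eq_online_assignment[symmetric] by blast
  have size: "scenario_size (map fst s) k' = card {j \<in> {1..?n}. j \<in> scenario I k'}"
    if "k' \<in> {1..3}" for k'
  proof -
    have "map fst s = rev (map (snd \<circ> revealed 3 I) [1..<Suc ?n])"
      by (simp add: s_def rev_map[symmetric] del: upt_Suc)
    then show ?thesis
      using that unfolding scenario_size_def by (simp only: length_filter_rev_map_upt)
        (auto simp: revealed_def intro!: arg_cong[where f = card])
  qed
  have load: "load s i k = card {j \<in> {1..?n}. ?\<sigma> j = i \<and> j \<in> scenario I k}"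
    using k unfolding load_def s_def by (simp only: length_filter_rev_map_upt)
      (auto simp: revealed_def intro!: arg_cong[where f = card])
  have "\<forall>k'\<in>{1..3}. scenario_size (map fst s) k' \<le> m * ?L"
    using size scenario_card_le_makespan[OF unit _ \<tau>] by simp
  then have "load s i k \<le> 2 * ?L" using bal k i unfolding balanced_def by blast
  then have "real (load s i k) \<le> 2 * real ?L" by linarith
  moreover have "real ?L \<le> makespan m 3 I \<tau>"
  proof -
    \<comment> \<open>\<open>nat\<close> sends negative numbers to 0, so the bound on
      \<open>?L\<close> needs a nonnegative makespan.\<close>
    have "0 \<le> makespan m 3 I \<tau>"
      using makespan_ge[OF k i, of I \<tau>] total_ptime_unit[OF unit, of \<tau> i "scenario I k"] by linarith
    then show ?thesis by simp
  qed
  ultimately show "total_ptime I (machine_jobs I ?\<sigma> i \<inter> scenario I k) \<le> 2 * makespan m 3 I \<tau>"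
    unfolding total_ptime_unit[OF unit] load by linarith
qed simp

theorem mainTheorem14:
  fixes m :: nat
  assumes "m \<ge> 1"
  shows "\<exists>A. online_algorithm m A \<and> competitive_on unit_instance 2 m 3 A"
proof (intro exI conjI)
  show "online_algorithm m (greedy_rule m)"
    by (rule online_algorithm_greedy_rule[OF assms])
  show "competitive_on unit_instance 2 m 3 (greedy_rule m)"
    unfolding competitive_on_def
  proof (intro allI impI)
    fix I assume I: "valid_instance 3 I \<and> unit_instance I"
    let ?F = "{1..num_jobs I} \<rightarrow>\<^sub>E {1..m}"
    \<comment> \<open>The minimum over a finite nonempty set is attained, which gives an optimal
      schedule to compare with.\<close>
    have "finite ?F" by (simp add: finite_PiE)
    moreover have "?F \<noteq> {}" using assms by (simp add: PiE_eq_empty_iff)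
    ultimately have "opt_makespan m 3 I \<in> makespan m 3 I ` ?F"
      unfolding opt_makespan_def by (intro Min_in) auto
    then obtain \<tau> where "\<tau> \<in> ?F" "opt_makespan m 3 I = makespan m 3 I \<tau>" by blast
    moreover from this have "\<tau> \<in> {1..num_jobs I} \<rightarrow> {1..m}" by (auto simp: PiE_def)
    ultimately show "makespan m 3 I (online_assignment 3 (greedy_rule m) I) \<le> 2 * opt_makespan m 3 I"
      using greedy_makespan_le[OF assms] I by simp
  qed
qed

end
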